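(* Let $\mathbf{n}=(n_1,\dots,n_d)\in\mathbb{N}^d$ be any multi-index of $d$ natural numbers (positive integers). Then the Poisson maps $R_{\mathbf{n}}\colon\mathbb{C}_\times^d\to\mathbb{R}$ and $\mathbf{J}_{\mathbf{n}}\colon\mathbb{C}_\times^d\to\mathbf{J}_{\mathbf{1}}(\mathbb{C}_\times^d)\subset\mathfrak{su}(d)^*_+$ are a dual pair; that is, for every $\mathbf{a}\in\mathbb{C}_\times^d$, the subspaces $\ker T_{\mathbf{a}}R_{\mathbf{n}}$ and $\ker T_{\mathbf{a}}\mathbf{J}_{\mathbf{n}}$ of $T_{\mathbf{a}}\mathbb{C}_\times^d$ are symplectic orthogonal complements of each other with respect to $\Omega$. Moreover, this dual pair of Poisson maps for the $\mathbf{n}$ resonance is related to the dual pair of momentum maps $R_{\mathbf{1}},\mathbf{J}_{\mathbf{1}}$ for the $\mathbf{1}$-resonance, $\mathbf{1}=(1,\dots,1)$, through the map $f_{\mathbf{n}}$: $$R_{\mathbf{n}}=R_{\mathbf{1}}\circ f_{\mathbf{n}},\qquad\mathbf{J}_{\mathbf{n}}=\mathbf{J}_{\mathbf{1}}\circ f_{\mathbf{n}}.$$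
   Context: $\mathbb{C}_\times=\mathbb{C}\setminus\{0\}$ and $\mathbb{C}_\times^d=\{\mathbf{a}=(a_1,\dots,a_d):a_j\in\mathbb{C}_\times\}$, regarded as a real $2d$-dimensional manifold with symplectic form $\Omega=-\frac{i}{2}\sum_{j=1}^d da_j\wedge d\bar a_j$ and associated Poisson bracket $$\{F,G\}=2i\sum_{j=1}^d\left(\frac{\partial F}{\partial a_j}\frac{\partial G}{\partial\bar a_j}-\frac{\partial G}{\partial a_j}\frac{\partial F}{\partial\bar a_j}\right).$$ $\mathbb{R}$ carries the zero Poisson bracket. For $\mathbf{n}=(n_1,\dots,n_d)$ set $\nu_j=\prod_{1\le i\le d,\,i\ne j}n_i$ and define $$f_{\mathbf{n}}\colon\mathbb{C}_\times^d\to\mathbb{C}_\times^d,\quad\mathbf{a}\mapsto\left(\frac{a_1^{\nu_1}}{\sqrt{\nu_1}\,|a_1|^{\nu_1-1}},\dots,\frac{a_d^{\nu_d}}{\sqrt{\nu_d}\,|a_d|^{\nu_d-1}}\right),\qquad R_{\mathbf{n}}(\mathbf{a})=\frac12\sum_{j=1}^d\frac{|a_j|^2}{\nu_j}.$$ Identify $\mathfrak{su}(d)^*$ with $\mathfrak{su}(d)$ via the inner product $\langle\eta,\xi\rangle=\frac12\operatorname{tr}(\eta^*\xi)$. $\mathfrak{su}(d)^*_+$ denotes $\mathfrak{su}(d)^*$ with the $(+)$-Lie--Poisson bracket $\{F,G\}_+(\mu)=\langle\mu,[\partial F/\partial\mu,\partial G/\partial\mu]\rangle$. The map $\mathbf{J}_{\mathbf{1}}\colon\mathbb{C}_\times^d\to\mathfrak{su}(d)^*$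 is $$\mathbf{J}_{\mathbf{1}}(\mathbf{b})=i\left(\mathbf{b}\mathbf{b}^*-\frac1d|\mathbf{b}|^2I\right)$$ (the momentum map for the natural $\mathsf{SU}(d)$-action $(U,\mathbf{b})\mapsto U\mathbf{b}$), and $\mathbf{J}_{\mathbf{n}}:=\mathbf{J}_{\mathbf{1}}\circ f_{\mathbf{n}}$, with codomain the image $\mathbf{J}_{\mathbf{1}}(\mathbb{C}_\times^d)$ and the Poisson property understood with respect to the $(+)$-Lie--Poisson bracket on $\mathfrak{su}(d)^*$.
   Formalization: The formal theorem assumes d ≥ 2; for d = 1 the statement fails, since su(1) = 0 makes J_n constant, so its tangent kernel is two-dimensional while the symplectic complement of ker TR_n is one-dimensional. *)

theory Defs
  imports "HOL-Analysis.Analysis"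
begin

text \<open>
  \<open>complex ^ 'd\<close> is regarded as a real vector space of dimension \<open>2 * CARD('d)\<close>;
  \<open>punctured_space\<close> is an open subset of it, so every tangent space is \<open>complex ^ 'd\<close> and
  the tangent map of \<open>f\<close> at \<open>a\<close> is \<open>frechet_derivative f (at a)\<close>.
\<close>

definition punctured_space :: "(complex ^ 'd) set" where
  "punctured_space = {a. \<forall>j. a $ j \<noteq> 0}"

primrec higher_differentiable_on ::
    "'a::real_normed_vector set \<Rightarrow> ('a \<Rightarrow> 'b::real_normed_vector) \<Rightarrow> nat \<Rightarrow> bool" where
  "higher_differentiable_on S f 0 \<longleftrightarrow> continuous_on S f"
| "higher_differentiable_on S f (Suc k) \<longleftrightarrow>
     (\<forall>x\<in>S. f differentiable (at x)) \<and>
     (\<forall>v. higher_differentiable_on S (\<lambda>x. frechet_derivative f (at x) v) k)"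

text \<open>For open subsets of finite-dimensional spaces, this is the class of infinitely
  differentiable maps.\<close>

definition smooth_on :: "'a::real_normed_vector set \<Rightarrow> ('a \<Rightarrow> 'b::real_normed_vector) \<Rightarrow> bool" where
  "smooth_on S f \<longleftrightarrow> (\<forall>k. higher_differentiable_on S f k)"


subsection \<open>Symplectic form and Poisson bracket on the punctured space\<close>

text \<open>Here \<open>(da \<and> dc)(u, v) = da(u) dc(v) - da(v) dc(u)\<close> with \<open>c\<close> the conjugate of \<open>a\<close>.
  The complex number under \<open>Re\<close> is real.\<close>

definition Omega :: "complex ^ 'd \<Rightarrow> complex ^ 'd \<Rightarrow> real" where
  "Omega u v = Re (- (\<i> / 2) * (\<Sum>j\<in>UNIV. u $ j * cnj (v $ j) - v $ j * cnj (u $ j)))"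

text \<open>The Wirtinger derivatives: half of the x-derivative minus (respectively plus) \<open>\<i>\<close> times
  the y-derivative, where \<open>a\<^sub>j = x + \<i> y\<close>.\<close>

definition d_hol :: "(complex ^ 'd \<Rightarrow> real) \<Rightarrow> 'd \<Rightarrow> complex ^ 'd \<Rightarrow> complex" where
  "d_hol F j a =
     (of_real (frechet_derivative F (at a) (axis j 1))
      - \<i> * of_real (frechet_derivative F (at a) (axis j \<i>))) / 2"

definition d_antihol :: "(complex ^ 'd \<Rightarrow> real) \<Rightarrow> 'd \<Rightarrow> complex ^ 'd \<Rightarrow> complex" where
  "d_antihol F j a =
     (of_real (frechet_derivative F (at a) (axis j 1))
      + \<i> * of_real (frechet_derivative F (at a) (axis j \<i>))) / 2"

text \<open>For real-valued \<open>F\<close>, \<open>G\<close> the complex number under \<open>Re\<close> is real.\<close>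

definition canonical_bracket ::
    "(complex ^ 'd \<Rightarrow> real) \<Rightarrow> (complex ^ 'd \<Rightarrow> real) \<Rightarrow> complex ^ 'd \<Rightarrow> real" where
  "canonical_bracket F G a =
     Re (2 * \<i> * (\<Sum>j\<in>UNIV. d_hol F j a * d_antihol G j a - d_hol G j a * d_antihol F j a))"

definition zero_bracket :: "(real \<Rightarrow> real) \<Rightarrow> (real \<Rightarrow> real) \<Rightarrow> real \<Rightarrow> real" where
  "zero_bracket F G x = 0"


subsection \<open>The Lie--Poisson bracket on the dual of su(d)\<close>

definition conj_transpose :: "complex ^ 'n ^ 'm \<Rightarrow> complex ^ 'm ^ 'n" where
  "conj_transpose A = (\<chi> i j. cnj (A $ j $ i))"

definition su :: "(complex ^ 'd ^ 'd) set" where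
  "su = {A. conj_transpose A = - A \<and> trace A = 0}"

text \<open>On \<open>su\<close> the trace below is real; this inner product identifies \<open>su\<close> with its dual.\<close>

definition su_inner :: "complex ^ 'd ^ 'd \<Rightarrow> complex ^ 'd ^ 'd \<Rightarrow> real" where
  "su_inner \<eta> \<xi> = Re (trace (conj_transpose \<eta> ** \<xi>)) / 2"

text \<open>Functions on \<open>su\<close> are represented by functions on the ambient matrix space. Every smooth
  function on \<open>su\<close> is the restriction of a smooth ambient one, and at \<open>\<mu> \<in> su\<close> the gradient, hence
  the bracket, depends only on the restriction to \<open>su\<close>. The gradient exists and is unique because
  \<open>su_inner\<close> is positive definite on \<open>su\<close>.\<close>

definition su_grad :: "(complex ^ 'd ^ 'd \<Rightarrow> real) \<Rightarrow> complex ^ 'd ^ 'd \<Rightarrow> complex ^ 'd ^ 'd" where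
  "su_grad F \<mu> =
     (THE \<delta>. \<delta> \<in> su \<and> (\<forall>\<xi>\<in>su. su_inner \<delta> \<xi> = frechet_derivative F (at \<mu>) \<xi>))"

definition commutator :: "complex ^ 'd ^ 'd \<Rightarrow> complex ^ 'd ^ 'd \<Rightarrow> complex ^ 'd ^ 'd" where
  "commutator A B = A ** B - B ** A"

definition lie_poisson_bracket ::
    "(complex ^ 'd ^ 'd \<Rightarrow> real) \<Rightarrow> (complex ^ 'd ^ 'd \<Rightarrow> real) \<Rightarrow> complex ^ 'd ^ 'd \<Rightarrow> real" where
  "lie_poisson_bracket F G \<mu> = su_inner \<mu> (commutator (su_grad F \<mu>) (su_grad G \<mu>))"


subsection \<open>Poisson maps and dual pairs\<close>

text \<open>A Poisson map from the open set \<open>S\<close> to the subset \<open>T\<close> of a space whose smooth functions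
  carry the bracket \<open>brT\<close>.\<close>

definition poisson_map ::
    "'a::real_normed_vector set \<Rightarrow> (('a \<Rightarrow> real) \<Rightarrow> ('a \<Rightarrow> real) \<Rightarrow> 'a \<Rightarrow> real) \<Rightarrow>
     'b::real_normed_vector set \<Rightarrow> (('b \<Rightarrow> real) \<Rightarrow> ('b \<Rightarrow> real) \<Rightarrow> 'b \<Rightarrow> real) \<Rightarrow>
     ('a \<Rightarrow> 'b) \<Rightarrow> bool" where
  "poisson_map S brS T brT \<phi> \<longleftrightarrow>
     smooth_on S \<phi> \<and> \<phi> ` S \<subseteq> T \<and>
     (\<forall>F G. smooth_on UNIV F \<longrightarrow> smooth_on UNIV G \<longrightarrow>
        (\<forall>a\<in>S. brS (F \<circ> \<phi>) (G \<circ> \<phi>) a = brT F G (\<phi> a)))"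

definition tangent_kernel ::
    "('a::real_normed_vector \<Rightarrow> 'b::real_normed_vector) \<Rightarrow> 'a \<Rightarrow> 'a set" where
  "tangent_kernel \<phi> a = {v. frechet_derivative \<phi> (at a) v = 0}"

definition symplectic_orthogonal :: "(complex ^ 'd) set \<Rightarrow> (complex ^ 'd) set" where
  "symplectic_orthogonal V = {u. \<forall>v\<in>V. Omega u v = 0}"

definition dual_pair ::
    "(complex ^ 'd) set \<Rightarrow> (complex ^ 'd \<Rightarrow> 'b::real_normed_vector) \<Rightarrow>
     (complex ^ 'd \<Rightarrow> 'c::real_normed_vector) \<Rightarrow> bool" where
  "dual_pair S \<phi> \<psi> \<longleftrightarrow>
     (\<forall>a\<in>S. tangent_kernel \<phi> a = symplectic_orthogonal (tangent_kernel \<psi> a) \<and>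
            tangent_kernel \<psi> a = symplectic_orthogonal (tangent_kernel \<phi> a))"


subsection \<open>The resonance maps\<close>

definition nu :: "('d::finite \<Rightarrow> nat) \<Rightarrow> 'd \<Rightarrow> nat" where
  "nu n j = (\<Prod>i\<in>UNIV - {j}. n i)"

text \<open>For positive \<open>n\<close> one has \<open>nu n j \<ge> 1\<close>, so the subtraction on \<open>nat\<close> is not truncated.\<close>

definition f_res :: "('d::finite \<Rightarrow> nat) \<Rightarrow> complex ^ 'd \<Rightarrow> complex ^ 'd" where
  "f_res n a =
     (\<chi> j. (a $ j) ^ nu n j / of_real (sqrt (real (nu n j)) * norm (a $ j) ^ (nu n j - 1)))"

definition R_res :: "('d::finite \<Rightarrow> nat) \<Rightarrow> complex ^ 'd \<Rightarrow> real" where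
  "R_res n a = (1 / 2) * (\<Sum>j\<in>UNIV. (norm (a $ j))\<^sup>2 / real (nu n j))"

definition J_one :: "complex ^ 'd \<Rightarrow> complex ^ 'd ^ 'd" where
  "J_one b =
     (\<chi> i j. \<i> * (b $ i * cnj (b $ j)
                   - of_real ((norm b)\<^sup>2 / real CARD('d)) * (if i = j then 1 else 0)))"

definition J_res :: "('d::finite \<Rightarrow> nat) \<Rightarrow> complex ^ 'd \<Rightarrow> complex ^ 'd ^ 'd" where
  "J_res n = J_one \<circ> f_res n"

end

theory Submission
  imports Defs
begin

text \<open>
  In polar coordinates each coordinate of \<open>f_res n\<close> multiplies the angle by \<open>m = nu n j\<close> and divides
  the radius by \<open>sqrt m\<close>. The area form \<open>r dr \<and> d\<theta>\<close> is therefore preserved, so \<open>f_res n\<close> is a local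
  symplectomorphism of the punctured space (\<open>D_f_res_symplectic\<close>, \<open>D_f_res_surj\<close>), and both the Poisson
  property and the duality for \<open>n\<close> are pulled back from the linear \<open>SU(d)\<close>-action.

  For that action everything follows from one identity, \<open>su_inner_D_J_one\<close>: the function
  \<open>su_inner \<delta> \<circ> J_one\<close> has differential \<open>Omega (\<delta> *v b)\<close>, i.e. it generates \<open>b \<mapsto> \<delta> *v b\<close>. The bracket
  of two functions is \<open>Omega\<close> of the vectors that represent their differentials
  (\<open>canonical_bracket_eq_Omega\<close>), so the bracket of \<open>F \<circ> J_one\<close> and \<open>G \<circ> J_one\<close> is
  \<open>Omega (\<delta> *v b) (\<epsilon> *v b)\<close> for the gradients \<open>\<delta>\<close>, \<open>\<epsilon>\<close>; since \<open>J_one\<close> is quadratic, the same identity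
  turns this into the Lie--Poisson bracket (\<open>su_inner_J_one_commutator\<close>).

  For the duality, the differential of \<open>R_res n\<close> is \<open>Omega X\<close> with \<open>X = resonance_field n a\<close>, so its
  kernel is the symplectic complement of the line through \<open>X\<close>. That line is the kernel of the differential of
  \<open>J_res n\<close>: the matrix \<open>b b\<^sup>*\<close> determines \<open>b\<close> up to a common phase, and at the infinitesimal level
  the trace part of \<open>J_one\<close> loses nothing more (\<open>D_J_one_eq_0_iff\<close>), while \<open>f_res n\<close> carries \<open>X\<close> to
  the generator of the common phase rotation (\<open>D_f_res_resonance_field\<close>).
\<close>

section \<open>Smooth maps on open sets\<close>

text \<open>Openness makes the derivatives at the points of \<open>S\<close> depend only on the values on \<open>S\<close>.\<close>

lemma higher_differentiable_on_cong:
  assumes "open S" and "\<And>x. x \<in> S \<Longrightarrow> f x = g x"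
    and "higher_differentiable_on S f k"
  shows "higher_differentiable_on S g k"
  using assms(2,3)
proof (induction k arbitrary: f g)
  case 0
  then show ?case by (simp cong: continuous_on_cong)
next
  case (Suc k)
  have der: "(g has_derivative frechet_derivative f (at x)) (at x)" if "x \<in> S" for x
    by (rule has_derivative_transform_within_open[OF _ \<open>open S\<close> that Suc.prems(1)])
      (use Suc.prems(2) that in \<open>auto simp flip: frechet_derivative_works\<close>)
  have eq: "frechet_derivative f (at x) v = frechet_derivative g (at x) v" if "x \<in> S" for x v
    using frechet_derivative_at[OF der[OF that]] by simp
  have "higher_differentiable_on S (\<lambda>x. frechet_derivative g (at x) v) k" for v
    by (rule Suc.IH[OF eq]) (use Suc.prems(2) in auto)
  with der show ?case
    unfolding higher_differentiable_on.simps differentiable_def by blast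
qed

text \<open>This allows any explicit formula, valid on \<open>S\<close> only, to replace the total function
  \<open>frechet_derivative f\<close>.\<close>

lemma higher_differentiable_on_SucI:
  assumes "open S" and der: "\<And>x. x \<in> S \<Longrightarrow> (f has_derivative f' x) (at x)"
    and "\<And>v. higher_differentiable_on S (\<lambda>x. f' x v) k"
  shows "higher_differentiable_on S f (Suc k)"
proof -
  have "f' x v = frechet_derivative f (at x) v" if "x \<in> S" for x v
    using frechet_derivative_at[OF der[OF that]] by simp
  then have "higher_differentiable_on S (\<lambda>x. frechet_derivative f (at x) v) k" for v
    by (rule higher_differentiable_on_cong[OF \<open>open S\<close> _ assms(3)])
  with der show ?thesis
    unfolding higher_differentiable_on.simps differentiable_def by blast
qed

lemma higher_differentiable_on_has_derivative:
  assumes "higher_differentiable_on S f (Suc k)" "x \<in> S"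
  shows "(f has_derivative frechet_derivative f (at x)) (at x)"
  using assms by (auto simp flip: frechet_derivative_works)

lemma higher_differentiable_on_SucD:
  "higher_differentiable_on S f (Suc k) \<Longrightarrow> higher_differentiable_on S f k"
proof (induction k arbitrary: f)
  case 0
  then show ?case
    by (auto intro!: differentiable_imp_continuous_on differentiable_at_imp_differentiable_on)
next
  case (Suc k)
  then show ?case by (metis higher_differentiable_on.simps(2))
qed

lemma higher_differentiable_on_const:
  "higher_differentiable_on S (\<lambda>x. c) k"
proof (induction k arbitrary: c)
  case (Suc k)
  then show ?case by (auto simp: frechet_derivative_const)
qed simp

lemma higher_differentiable_on_compose_bounded_linear:
  assumes "open S" "bounded_linear L" "higher_differentiable_on S f k"
  shows "higher_differentiable_on S (\<lambda>x. L (f x)) k"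
  using assms(3)
proof (induction k arbitrary: f)
  case 0
  then show ?case
    using bounded_linear.continuous_on[OF assms(2)] by auto
next
  case (Suc k)
  show ?case
  proof (rule higher_differentiable_on_SucI[OF \<open>open S\<close>])
    show "((\<lambda>x. L (f x)) has_derivative (\<lambda>v. L (frechet_derivative f (at x) v))) (at x)"
      if "x \<in> S" for x
      by (rule bounded_linear.has_derivative[OF assms(2)
            higher_differentiable_on_has_derivative[OF Suc.prems that]])
  qed (use Suc in auto)
qed

lemma higher_differentiable_on_bounded_linear:
  assumes "open S" "bounded_linear L"
  shows "higher_differentiable_on S L k"
proof (cases k)
  case 0
  then show ?thesis
    using linear_continuous_on[OF assms(2)] by simp
next
  case (Suc m)
  show ?thesis unfolding Suc
    by (rule higher_differentiable_on_SucI[OF \<open>open S\<close>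
          bounded_linear.has_derivative[OF assms(2) has_derivative_ident]
          higher_differentiable_on_const])
qed

lemma higher_differentiable_on_add:
  assumes "open S" "higher_differentiable_on S f k" "higher_differentiable_on S g k"
  shows "higher_differentiable_on S (\<lambda>x. f x + g x) k"
  using assms(2,3)
proof (induction k arbitrary: f g)
  case 0
  then show ?case by (auto intro: continuous_on_add)
next
  case (Suc k)
  show ?case
  proof (rule higher_differentiable_on_SucI[OF \<open>open S\<close>])
    show "((\<lambda>x. f x + g x) has_derivative
        (\<lambda>v. frechet_derivative f (at x) v + frechet_derivative g (at x) v)) (at x)"
      if "x \<in> S" for x
      by (intro has_derivative_add Suc.prems[THEN higher_differentiable_on_has_derivative, OF that])
  qed (use Suc in auto)
qed

lemma higher_differentiable_on_sum:
  assumes "open S" "finite I" "\<And>i. i \<in> I \<Longrightarrow> higher_differentiable_on S (f i) k"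
  shows "higher_differentiable_on S (\<lambda>x. \<Sum>i\<in>I. f i x) k"
  using assms(2,3)
  by (induction I rule: finite_induct)
    (auto intro: higher_differentiable_on_const higher_differentiable_on_add[OF \<open>open S\<close>])

lemma higher_differentiable_on_bilinear:
  assumes "open S" "bounded_bilinear B"
    "higher_differentiable_on S f k" "higher_differentiable_on S g k"
  shows "higher_differentiable_on S (\<lambda>x. B (f x) (g x)) k"
  using assms(3,4)
proof (induction k arbitrary: f g)
  case 0
  then show ?case using bounded_bilinear.continuous_on[OF assms(2)] by auto
next
  case (Suc k)
  show ?case
  proof (rule higher_differentiable_on_SucI[OF \<open>open S\<close>])
    show "((\<lambda>x. B (f x) (g x)) has_derivative
        (\<lambda>v. B (f x) (frechet_derivative g (at x) v) + B (frechet_derivative f (at x) v) (g x)))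
        (at x)" if "x \<in> S" for x
      by (intro bounded_bilinear.FDERIV[OF assms(2)]
          Suc.prems[THEN higher_differentiable_on_has_derivative, OF that])
    show "higher_differentiable_on S (\<lambda>x. B (f x) (frechet_derivative g (at x) v)
        + B (frechet_derivative f (at x) v) (g x)) k" for v
      by (intro higher_differentiable_on_add[OF \<open>open S\<close>] Suc.IH
          higher_differentiable_on_SucD[OF Suc.prems(1)]
          higher_differentiable_on_SucD[OF Suc.prems(2)])
        (use Suc.prems in auto)
  qed
qed

lemma higher_differentiable_on_power:
  fixes f :: "'a::real_normed_vector \<Rightarrow> 'b::real_normed_field"
  assumes "open S" "higher_differentiable_on S f k"
  shows "higher_differentiable_on S (\<lambda>x. f x ^ m) k"
  by (induction m)
    (auto intro: higher_differentiable_on_const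
      higher_differentiable_on_bilinear[OF \<open>open S\<close> bounded_bilinear_mult assms(2)])

lemma bounded_linear_axis: "bounded_linear (axis i :: 'b::euclidean_space \<Rightarrow> 'b ^ 'i)"
  by (rule linear_conv_bounded_linear[THEN iffD1], rule linearI)
    (auto simp: vec_eq_iff axis_def)

lemma has_derivative_vec_lambda:
  fixes f :: "'i::finite \<Rightarrow> 'a::real_normed_vector \<Rightarrow> 'b::euclidean_space"
  assumes "\<And>i. (f i has_derivative f' i) (at x)"
  shows "((\<lambda>x. \<chi> i. f i x) has_derivative (\<lambda>v. \<chi> i. f' i v)) (at x)"
proof -
  have "(\<lambda>x. \<chi> i. g i x) = (\<lambda>x. \<Sum>i\<in>UNIV. axis i (g i x))" for g :: "'i \<Rightarrow> 'a \<Rightarrow> 'b"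
    by (auto simp: vec_eq_iff axis_def)
  then show ?thesis
    by (auto intro!: has_derivative_sum bounded_linear.has_derivative[OF bounded_linear_axis] assms)
qed

lemma higher_differentiable_on_vec_lambda:
  fixes f :: "'i::finite \<Rightarrow> 'a::real_normed_vector \<Rightarrow> 'b::euclidean_space"
  assumes "open S" "\<And>i. higher_differentiable_on S (f i) k"
  shows "higher_differentiable_on S (\<lambda>x. \<chi> i. f i x) k"
proof -
  have "(\<lambda>x. \<chi> i. f i x) = (\<lambda>x. \<Sum>i\<in>UNIV. axis i (f i x))"
    by (auto simp: vec_eq_iff axis_def)
  then show ?thesis
    by (auto intro!: higher_differentiable_on_sum assms
        higher_differentiable_on_compose_bounded_linear[OF \<open>open S\<close> bounded_linear_axis])
qed

lemma has_derivative_inverse_norm: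
  fixes x :: "'a::real_inner"
  assumes "x \<noteq> 0"
  shows "((\<lambda>x. inverse (norm x)) has_derivative (\<lambda>v. - (x \<bullet> v) * inverse (norm x) ^ 3)) (at x)"
proof -
  have "((\<lambda>x. inverse (norm x)) has_derivative
      (\<lambda>v. - (inverse (norm x) * (v \<bullet> sgn x) * inverse (norm x)))) (at x)"
    using Deriv.has_derivative_inverse[OF _ has_derivative_norm[OF assms]] assms
    by (simp add: inner_commute)
  also have "(\<lambda>v. - (inverse (norm x) * (v \<bullet> sgn x) * inverse (norm x)))
      = (\<lambda>v. - (x \<bullet> v) * inverse (norm x) ^ 3)"
    by (auto simp: sgn_div_norm inner_commute power3_eq_cube)
  finally show ?thesis .
qed

text \<open>The directional derivative is a linear map times a power of the function itself, so the
  induction hypothesis for \<open>k\<close> derivatives yields one derivative more.\<close>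

lemma higher_differentiable_on_inverse_norm:
  fixes L :: "'a::real_normed_vector \<Rightarrow> 'b::euclidean_space"
  assumes "open S" "bounded_linear L" "\<And>x. x \<in> S \<Longrightarrow> L x \<noteq> 0"
  shows "higher_differentiable_on S (\<lambda>x. inverse (norm (L x))) k"
proof (induction k)
  case 0
  show ?case
    using assms(3) by (auto intro!: continuous_intros linear_continuous_on[OF assms(2)])
next
  case (Suc k)
  show ?case
  proof (rule higher_differentiable_on_SucI[OF \<open>open S\<close>])
    show "((\<lambda>x. inverse (norm (L x))) has_derivative
        (\<lambda>v. (- (L x \<bullet> L v)) * inverse (norm (L x)) ^ 3)) (at x)" if "x \<in> S" for x
      using has_derivative_compose[OF bounded_linear.has_derivative[OF assms(2) has_derivative_ident]
          has_derivative_inverse_norm[OF assms(3)[OF that]]] .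
    have "bounded_linear (\<lambda>x. - (L x \<bullet> L v))" for v
      by (intro bounded_linear_minus bounded_linear_inner_left_comp assms(2))
    then show "higher_differentiable_on S (\<lambda>x. (- (L x \<bullet> L v)) * inverse (norm (L x)) ^ 3) k" for v
      by (intro higher_differentiable_on_bilinear[OF \<open>open S\<close> bounded_bilinear_mult]
          higher_differentiable_on_bounded_linear[OF \<open>open S\<close>]
          higher_differentiable_on_power[OF \<open>open S\<close>] Suc.IH)
  qed
qed

section \<open>Hamiltonian vectors and the bracket on the punctured space\<close>

lemma Omega_eq_sum: "Omega u v = (\<Sum>j\<in>UNIV. Im (u $ j * cnj (v $ j)))"
proof -
  have *: "Re (- (\<i> / 2) * (x * cnj y - y * cnj x)) = Im (x * cnj y)" for x y
    by (simp add: field_simps)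
  show ?thesis
    by (simp only: Omega_def sum_distrib_left Re_sum *)
qed

lemma Omega_skew: "Omega v u = - Omega u v"
  unfolding Omega_eq_sum sum_negf[symmetric] by (rule sum.cong) (auto simp: algebra_simps)

lemma Omega_diff_left: "Omega (u - v) w = Omega u w - Omega v w"
  unfolding Omega_eq_sum by (simp add: algebra_simps sum.distrib sum_subtractf)

lemma Omega_diff_right: "Omega w (u - v) = Omega w u - Omega w v"
  by (metis Omega_diff_left Omega_skew minus_diff_minus minus_diff_eq)

lemma Omega_scaleR_left: "Omega (c *\<^sub>R u) w = c * Omega u w"
  unfolding Omega_eq_sum sum_distrib_left by (rule sum.cong) (auto simp: algebra_simps)

lemma Omega_scaleR_right: "Omega w (c *\<^sub>R u) = c * Omega w u"
  by (metis Omega_scaleR_left Omega_skew mult_minus_right)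

lemma Omega_axis_right:
  "Omega u (axis j c) = Im (u $ j * cnj c)"
proof -
  have "Omega u (axis j c) = (\<Sum>i\<in>UNIV. if i = j then Im (u $ j * cnj c) else 0)"
    unfolding Omega_eq_sum by (rule sum.cong) (auto simp: axis_def)
  then show ?thesis by simp
qed

lemma Omega_nondegenerate:
  assumes "\<And>v. Omega u v = 0"
  shows "u = 0"
proof -
  have "u $ j = 0" for j
    using assms[of "axis j 1"] assms[of "axis j \<i>"]
    by (simp add: Omega_axis_right complex_eq_iff)
  then show ?thesis by (simp add: vec_eq_iff)
qed

text \<open>The values of \<open>Omega p\<close> on \<open>axis j 1\<close> and \<open>axis j \<i>\<close> are \<open>Im p\<^sub>j\<close> and \<open>- Re p\<^sub>j\<close>, so a Wirtinger
  derivative is \<open>\<plusminus>\<i>/2\<close> times \<open>p\<^sub>j\<close> or its conjugate; the factor \<open>2\<i>\<close> makes the signs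
  agree.\<close>

lemma canonical_bracket_eq_Omega:
  assumes "(F has_derivative (\<lambda>v. Omega p v)) (at a)"
    and "(G has_derivative (\<lambda>v. Omega q v)) (at a)"
  shows "canonical_bracket F G a = Omega p q"
proof -
  have "frechet_derivative F (at a) = Omega p" "frechet_derivative G (at a) = Omega q"
    using assms by (auto dest: frechet_derivative_at)
  then have "canonical_bracket F G a = (\<Sum>j\<in>UNIV. Re (2 * \<i> *
      (((of_real (Im (p $ j)) + \<i> * of_real (Re (p $ j))) / 2) * ((of_real (Im (q $ j)) - \<i> * of_real (Re (q $ j))) / 2)
     - ((of_real (Im (q $ j)) + \<i> * of_real (Re (q $ j))) / 2) * ((of_real (Im (p $ j)) - \<i> * of_real (Re (p $ j))) / 2))))"
    by (simp add: canonical_bracket_def d_hol_def d_antihol_def Omega_axis_right sum_distrib_left del: Re_divide_numeral)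
  also have "\<dots> = (\<Sum>j\<in>UNIV. Im (p $ j * cnj (q $ j)))"
    by (rule sum.cong) (simp_all add: field_simps)
  finally show ?thesis by (simp add: Omega_eq_sum)
qed

text \<open>If the functional \<open>Omega u\<close> vanishes on the kernel of \<open>Omega X\<close>, the two functionals are
  proportional, hence so are \<open>u\<close> and \<open>X\<close> by nondegeneracy.\<close>

lemma symplectic_orthogonal_hyperplane:
  assumes "X \<noteq> 0"
  shows "symplectic_orthogonal {v. Omega X v = 0} = range (\<lambda>t. t *\<^sub>R X)"
proof (intro equalityI subsetI)
  fix u assume u: "u \<in> symplectic_orthogonal {v. Omega X v = 0}"
  obtain w where w: "Omega X w \<noteq> 0"
    using Omega_nondegenerate assms by blast
  define t where "t = Omega u w / Omega X w"
  have "Omega (u - t *\<^sub>R X) v = 0" for v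
  proof -
    have "Omega X (v - (Omega X v / Omega X w) *\<^sub>R w) = 0"
      using w by (simp add: Omega_diff_right Omega_scaleR_right)
    then have "Omega u (v - (Omega X v / Omega X w) *\<^sub>R w) = 0"
      using u by (auto simp: symplectic_orthogonal_def)
    then show ?thesis
      using w by (simp add: t_def Omega_diff_left Omega_diff_right Omega_scaleR_left
          Omega_scaleR_right field_simps)
  qed
  then have "u = t *\<^sub>R X"
    using Omega_nondegenerate by fastforce
  then show "u \<in> range (\<lambda>t. t *\<^sub>R X)" by blast
qed (auto simp: symplectic_orthogonal_def Omega_scaleR_left)

lemma symplectic_orthogonal_line:
  "symplectic_orthogonal (range (\<lambda>t. t *\<^sub>R X)) = {v. Omega X v = 0}"
  unfolding symplectic_orthogonal_def
  by (auto simp: Omega_scaleR_right Omega_skew[of X] dest: spec[of _ 1])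


section \<open>The inner product and gradients on su(d)\<close>

lemma su_inner_eq_inner: "su_inner \<eta> \<xi> = (\<eta> \<bullet> \<xi>) / 2"
  unfolding su_inner_def trace_def conj_transpose_def matrix_matrix_mult_def inner_vec_def
  by (subst sum.swap) (simp add: inner_complex_def)

lemma su_entry:
  assumes "\<delta> \<in> su"
  shows "cnj (\<delta> $ i $ j) = - \<delta> $ j $ i"
proof -
  have "conj_transpose \<delta> $ j $ i = (- \<delta>) $ j $ i"
    using assms by (simp only: su_def mem_Collect_eq)
  then show ?thesis by (simp add: conj_transpose_def)
qed

lemma su_iff: "\<delta> \<in> su \<longleftrightarrow> (\<forall>i j. cnj (\<delta> $ i $ j) = - \<delta> $ j $ i) \<and> (\<Sum>i\<in>UNIV. \<delta> $ i $ i) = 0"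
  unfolding su_def conj_transpose_def trace_def vec_eq_iff by auto

lemma subspace_su: "subspace su"
  by (rule subspaceI) (auto simp: su_iff sum.distrib simp flip: scaleR_right.sum)

lemma cnj_matrix_product_su:
  assumes "\<delta> \<in> su" "\<epsilon> \<in> su"
  shows "cnj ((\<delta> ** \<epsilon>) $ i $ j) = (\<epsilon> ** \<delta>) $ j $ i"
  using assms by (simp add: matrix_matrix_mult_def su_entry mult.commute)

lemma commutator_in_su:
  assumes "\<delta> \<in> su" "\<epsilon> \<in> su"
  shows "commutator \<delta> \<epsilon> \<in> su"
proof -
  have "trace (commutator \<delta> \<epsilon>) = 0"
    unfolding commutator_def trace_sub by (subst trace_mul_sym) (rule right_minus_eq[THEN iffD2, OF refl])
  moreover have "cnj (commutator \<delta> \<epsilon> $ i $ j) = - commutator \<delta> \<epsilon> $ j $ i" for i j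
    unfolding commutator_def vector_minus_component complex_cnj_diff
      cnj_matrix_product_su[OF assms] cnj_matrix_product_su[OF assms(2,1)] by simp
  ultimately show ?thesis by (simp add: su_iff trace_def)
qed

lemma su_grad:
  assumes "F differentiable (at \<mu>)"
  shows "su_grad F \<mu> \<in> su"
    and "\<xi> \<in> su \<Longrightarrow> su_inner (su_grad F \<mu>) \<xi> = frechet_derivative F (at \<mu>) \<xi>"
proof -
  let ?D = "frechet_derivative F (at \<mu>)"
  \<comment> \<open>The ambient gradient is \<open>adjoint ?D 1\<close>; its orthogonal projection to \<open>su\<close>, doubled because
    of the factor 1/2 in the inner product, represents the restriction of \<open>?D\<close>.\<close>
  obtain y z where yz: "y \<in> su" "\<And>w. w \<in> su \<Longrightarrow> orthogonal z w" "adjoint ?D 1 = y + z"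
    using orthogonal_subspace_decomp_exists[of su "adjoint ?D 1"]
    unfolding span_eq_iff[THEN iffD2, OF subspace_su] by blast
  have rep: "su_inner (2 *\<^sub>R y) \<xi> = ?D \<xi>" if "\<xi> \<in> su" for \<xi>
  proof -
    have "?D \<xi> = \<xi> \<bullet> adjoint ?D 1"
      using adjoint_works[OF linear_frechet_derivative[OF assms], of \<xi> 1] by simp
    then show ?thesis
      using yz(2)[OF that] by (simp add: yz(3) su_inner_eq_inner orthogonal_def inner_add_right inner_commute)
  qed
  have mem: "2 *\<^sub>R y \<in> su" by (rule subspace_scale[OF subspace_su yz(1)])
  have "su_grad F \<mu> \<in> su \<and> (\<forall>\<xi>\<in>su. su_inner (su_grad F \<mu>) \<xi> = ?D \<xi>)"
    unfolding su_grad_def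
  proof (rule theI[of _ "2 *\<^sub>R y"])
    fix \<delta> assume \<delta>: "\<delta> \<in> su \<and> (\<forall>\<xi>\<in>su. su_inner \<delta> \<xi> = ?D \<xi>)"
    have "\<delta> - 2 *\<^sub>R y \<in> su" using \<delta> mem subspace_diff[OF subspace_su] by blast
    then have "su_inner \<delta> (\<delta> - 2 *\<^sub>R y) = su_inner (2 *\<^sub>R y) (\<delta> - 2 *\<^sub>R y)"
      using \<delta> rep by simp
    then have "(\<delta> - 2 *\<^sub>R y) \<bullet> (\<delta> - 2 *\<^sub>R y) = 0"
      by (simp add: su_inner_eq_inner inner_diff_left)
    then show "\<delta> = 2 *\<^sub>R y" by simp
  qed (use mem rep in auto)
  then show "su_grad F \<mu> \<in> su"
    and "\<xi> \<in> su \<Longrightarrow> su_inner (su_grad F \<mu>) \<xi> = ?D \<xi>" by auto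
qed


section \<open>The momentum map of the linear action\<close>

definition D_J_one :: "complex ^ 'd \<Rightarrow> complex ^ 'd \<Rightarrow> complex ^ 'd ^ 'd" where
  "D_J_one b v =
     (\<chi> i j. \<i> * (v $ i * cnj (b $ j) + b $ i * cnj (v $ j)
                   - of_real (2 * (b \<bullet> v) / real CARD('d)) * (if i = j then 1 else 0)))"

lemma has_derivative_J_one: "(J_one has_derivative D_J_one b) (at b)"
proof -
  have eq: "J_one = (\<lambda>b :: complex ^ 'd. \<chi> i j. \<i> * (b $ i * cnj (b $ j)
      - of_real (b \<bullet> b / real CARD('d)) * (if i = j then 1 else 0)))"
    by (auto simp: J_one_def power2_norm_eq_inner)
  show ?thesis unfolding eq D_J_one_def[abs_def]
    by (rule has_derivative_vec_lambda, rule has_derivative_vec_lambda)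
      (auto intro!: derivative_eq_intros bounded_linear_imp_has_derivative bounded_linear_vec_nth
        simp: inner_commute field_simps)
qed

text \<open>Euler's identity: \<open>J_one\<close> is homogeneous of degree two.\<close>

lemma D_J_one_self: "D_J_one b b = 2 *\<^sub>R J_one b"
  by (simp add: D_J_one_def J_one_def vec_eq_iff power2_norm_eq_inner scaleR_conv_of_real field_simps)

lemma sum_mult_cnj_self: "(\<Sum>i\<in>UNIV. v $ i * cnj (b $ i) + b $ i * cnj (v $ i)) = of_real (2 * (b \<bullet> v))"
  by (simp add: inner_vec_def inner_complex_def complex_eq_iff sum_distrib_left algebra_simps)

text \<open>The trace vanishes because \<open>b \<bullet> v\<close> is the real part of the Hermitian product.\<close>

lemma D_J_one_in_su: "D_J_one b v \<in> su"
proof -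
  have "(\<Sum>i\<in>UNIV. D_J_one b v $ i $ i) =
      \<i> * ((\<Sum>i\<in>UNIV. v $ i * cnj (b $ i) + b $ i * cnj (v $ i)) - of_real (2 * (b \<bullet> v)))"
    by (simp add: D_J_one_def sum_subtractf sum.distrib flip: sum_distrib_left)
  then show ?thesis
    unfolding su_iff by (simp add: sum_mult_cnj_self) (simp add: D_J_one_def algebra_simps)
qed

lemma J_one_in_su: "J_one b \<in> su"
proof -
  have "J_one b = (1/2) *\<^sub>R D_J_one b b" by (simp add: D_J_one_self)
  then show ?thesis using subspace_scale[OF subspace_su D_J_one_in_su] by metis
qed

text \<open>The momentum map identity: the Hamiltonian \<open>su_inner \<delta> \<circ> J_one\<close> generates the
  infinitesimal action \<open>b \<mapsto> \<delta> *v b\<close>.\<close>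

lemma su_inner_D_J_one:
  fixes \<delta> :: "complex ^ 'd ^ 'd"
  assumes "\<delta> \<in> su"
  shows "su_inner \<delta> (D_J_one b v) = Omega (\<delta> *v b) v"
proof -
  let ?c = "of_real (2 * (b \<bullet> v) / real CARD('d)) :: complex"
  define T where "T = (\<Sum>i\<in>UNIV. (\<delta> *v b) $ i * cnj (v $ i))"
  have T: "(\<Sum>k\<in>UNIV. \<Sum>i\<in>UNIV. \<delta> $ k $ i * b $ i * cnj (v $ k)) = T"
    by (simp add: T_def matrix_vector_mult_def sum_distrib_right)
  have 1: "(\<Sum>k\<in>UNIV. \<Sum>i\<in>UNIV. cnj (\<delta> $ k $ i) * (v $ k * cnj (b $ i))) = cnj T"
    unfolding T[symmetric] by (simp add: mult_ac)
  have 2: "(\<Sum>k\<in>UNIV. \<Sum>i\<in>UNIV. cnj (\<delta> $ k $ i) * (b $ k * cnj (v $ i))) = - T"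
    unfolding T[symmetric] su_entry[OF assms]
    by (subst sum.swap) (simp add: mult_ac sum_negf)
  have 3: "(\<Sum>k\<in>UNIV. \<Sum>i\<in>UNIV. cnj (\<delta> $ k $ i) * (c * (if k = i then 1 else 0))) = 0" for c
  proof -
    have "(\<Sum>k\<in>UNIV. \<Sum>i\<in>UNIV. cnj (\<delta> $ k $ i) * (c * (if k = i then 1 else 0)))
       = (\<Sum>k\<in>UNIV. \<Sum>i\<in>UNIV. if k = i then cnj (\<delta> $ k $ k) * c else 0)"
      by (intro sum.cong) auto
    also have "\<dots> = cnj (\<Sum>k\<in>UNIV. \<delta> $ k $ k) * c"
      by (simp only: sum.delta' finite UNIV_I if_True sum_distrib_right cnj_sum)
    also have "(\<Sum>k\<in>UNIV. \<delta> $ k $ k) = 0" using assms su_iff by blast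
    also have "cnj 0 * c = 0" by simp
    finally show ?thesis .
  qed
  have "su_inner \<delta> (D_J_one b v)
      = Re (\<Sum>k\<in>UNIV. \<Sum>i\<in>UNIV. cnj (\<delta> $ k $ i) * D_J_one b v $ k $ i) / 2"
    by (simp add: su_inner_eq_inner inner_vec_def inner_complex_def)
  also have "(\<Sum>k\<in>UNIV. \<Sum>i\<in>UNIV. cnj (\<delta> $ k $ i) * D_J_one b v $ k $ i)
      = (\<Sum>k\<in>UNIV. \<Sum>i\<in>UNIV. \<i> * (cnj (\<delta> $ k $ i) * (v $ k * cnj (b $ i))
          + cnj (\<delta> $ k $ i) * (b $ k * cnj (v $ i))
          - cnj (\<delta> $ k $ i) * (?c * (if k = i then 1 else 0))))"
    unfolding D_J_one_def vec_lambda_beta by (intro sum.cong refl) (simp only: algebra_simps)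
  also have "\<dots> = \<i> * (cnj T - T)"
    unfolding sum_distrib_left[symmetric] sum.distrib sum_subtractf 1 2 3 by simp
  also have "Re (\<i> * (cnj T - T)) / 2 = Im T" by simp
  finally show ?thesis by (simp add: T_def Omega_eq_sum)
qed

lemma Omega_su_skew:
  assumes "\<delta> \<in> su"
  shows "Omega (\<delta> *v u) v = - Omega u (\<delta> *v v)"
proof -
  have "(\<Sum>j\<in>UNIV. (\<delta> *v u) $ j * cnj (v $ j)) = - (\<Sum>j\<in>UNIV. u $ j * cnj ((\<delta> *v v) $ j))"
    unfolding matrix_vector_mult_def vec_lambda_beta cnj_sum complex_cnj_mult su_entry[OF assms]
      sum_distrib_left sum_distrib_right sum_negf[symmetric]
    by (subst sum.swap) (simp add: mult_ac)
  then show ?thesis by (simp only: Omega_eq_sum Im_sum[symmetric] uminus_complex.sel)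
qed

text \<open>By Euler's identity the left-hand side is half the value on \<open>b\<close> of the functional generating
  the action of the commutator. Both products in the commutator then contribute the same
  term, because \<open>\<delta>\<close> and \<open>\<epsilon>\<close> are skew for \<open>Omega\<close>.\<close>

lemma su_inner_J_one_commutator:
  assumes "\<delta> \<in> su" "\<epsilon> \<in> su"
  shows "su_inner (J_one b) (commutator \<delta> \<epsilon>) = Omega (\<delta> *v b) (\<epsilon> *v b)"
proof -
  let ?c = "commutator \<delta> \<epsilon>"
  have "su_inner (J_one b) ?c = su_inner ?c (D_J_one b b) / 2"
    by (simp add: su_inner_eq_inner D_J_one_self inner_commute)
  also have "\<dots> = Omega (\<delta> *v (\<epsilon> *v b) - \<epsilon> *v (\<delta> *v b)) b / 2"
    unfolding su_inner_D_J_one[OF commutator_in_su[OF assms]]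
    by (simp only: commutator_def matrix_vector_mul_assoc matrix_vector_mult_diff_rdistrib)
  also have "\<dots> = (Omega (\<epsilon> *v (\<delta> *v b)) b * (- 1) + Omega (\<delta> *v (\<epsilon> *v b)) b) / 2"
    by (simp add: Omega_diff_left)
  also have "\<dots> = Omega (\<delta> *v b) (\<epsilon> *v b)"
    by (simp add: Omega_su_skew assms Omega_skew[of "\<epsilon> *v b"])
  finally show ?thesis .
qed

text \<open>The stabiliser directions: writing \<open>v $ i = b $ i * \<zeta> i\<close>, the off-diagonal entries say
  \<open>\<zeta> i = - cnj (\<zeta> j)\<close>, so the real parts are opposite, while equality of all diagonal entries
  gives them equal signs. Hence all \<open>\<zeta> i\<close> are one and the same imaginary number. At
  least two coordinates are needed: for one coordinate the matrix vanishes for every \<open>v\<close>.\<close>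

lemma D_J_one_eq_0_iff:
  fixes b v :: "complex ^ 'd"
  assumes "CARD('d) \<ge> 2" and "b \<in> punctured_space"
  shows "D_J_one b v = 0 \<longleftrightarrow> (\<exists>t. v = t *\<^sub>R (\<chi> j. \<i> * b $ j))"
proof
  assume "\<exists>t. v = t *\<^sub>R (\<chi> j. \<i> * b $ j)"
  then obtain t where v: "v = t *\<^sub>R (\<chi> j. \<i> * b $ j)" ..
  have "b \<bullet> v = 0"
    unfolding v inner_vec_def by (rule sum.neutral) (auto simp: inner_complex_def)
  moreover have "v $ j = \<i> * of_real t * b $ j" for j
    unfolding v vector_scaleR_component vec_lambda_beta by (simp add: scaleR_conv_of_real)
  ultimately show "D_J_one b v = 0"
    unfolding D_J_one_def by (simp add: vec_eq_iff)
next
  assume zero: "D_J_one b v = 0"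
  have b: "b $ j \<noteq> 0" for j using assms(2) by (auto simp: punctured_space_def)
  define \<zeta> where "\<zeta> j = v $ j / b $ j" for j
  have v: "v $ j = b $ j * \<zeta> j" for j using b by (simp add: \<zeta>_def)
  let ?c = "2 * (b \<bullet> v) / real CARD('d)"
  have entry: "v $ i * cnj (b $ j) + b $ i * cnj (v $ j) = of_real ?c * (if i = j then 1 else 0)"
    for i j
  proof -
    have "D_J_one b v $ i $ j = 0" using zero by simp
    then show ?thesis
      unfolding D_J_one_def vec_lambda_beta by (simp only: mult_eq_0_iff complex_i_not_zero simp_thms right_minus_eq)
  qed
  have off: "\<zeta> i = - cnj (\<zeta> j)" if "i \<noteq> j" for i j
  proof -
    have "b $ i * cnj (b $ j) * (\<zeta> i + cnj (\<zeta> j)) = 0"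
      using entry[of i j] that by (simp add: v algebra_simps)
    then show ?thesis using b by (simp add: eq_neg_iff_add_eq_0)
  qed
  have diag: "2 * (norm (b $ i))\<^sup>2 * Re (\<zeta> i) = ?c" for i
  proof -
    have "Re (v $ i * cnj (b $ i) + b $ i * cnj (v $ i)) = ?c"
      unfolding entry by simp
    moreover have "Re (v $ i * cnj (b $ i) + b $ i * cnj (v $ i)) = 2 * (norm (b $ i))\<^sup>2 * Re (\<zeta> i)"
      unfolding v
        by (simp only: cmod_power2 times_complex.sel plus_complex.sel complex_cnj_mult cnj.sel, algebra)
    ultimately show ?thesis by simp
  qed
  have other: "\<exists>j. j \<noteq> i" for i :: 'd
  proof (rule ccontr)
    assume "\<nexists>j. j \<noteq> i"
    then have "(UNIV :: 'd set) = {i}" by auto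
    then have "CARD('d) = card {i}" by (rule arg_cong)
    also have "card {i} = 1" by simp
    finally show False using assms(1) by linarith
  qed
  have Re0: "Re (\<zeta> i) = 0" for i
  proof -
    obtain j where "j \<noteq> i" using other by blast
    then have "Re (\<zeta> j) = - Re (\<zeta> i)" by (simp add: off[of j i])
    define A where "A = (norm (b $ i))\<^sup>2 + (norm (b $ j))\<^sup>2"
    have "A > 0" using b[of i] by (simp add: A_def add_pos_nonneg)
    moreover have "A * Re (\<zeta> i) = 0"
      using diag[of i] diag[of j] unfolding \<open>Re (\<zeta> j) = _\<close> A_def distrib_right by linarith
    ultimately show ?thesis by simp
  qed
  fix k :: 'd
  define t where "t = Im (\<zeta> k)"
  have "\<zeta> i = \<i> * of_real t" for i
    using Re0[of i] Re0[of k] off[of i k] unfolding t_def by (cases "i = k") (simp_all add: complex_eq_iff)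
  then have "v = t *\<^sub>R (\<chi> j. \<i> * b $ j)"
    unfolding vec_eq_iff vector_scaleR_component vec_lambda_beta v
    by (simp add: scaleR_conv_of_real)
  then show "\<exists>t. v = t *\<^sub>R (\<chi> j. \<i> * b $ j)" ..
qed

section \<open>The resonance map is a local symplectomorphism\<close>

text \<open>One coordinate of \<open>f_res\<close>. In polar coordinates it multiplies the argument by \<open>m\<close> and
  divides the modulus by \<open>sqrt m\<close>.\<close>

definition res_coord :: "nat \<Rightarrow> complex \<Rightarrow> complex" where
  "res_coord m z = z ^ m / of_real (sqrt (real m) * norm z ^ (m - 1))"

text \<open>In terms of \<open>w / z\<close>, whose real part is the logarithmic radial velocity and whose imaginary
  part is the angular velocity, the derivative fixes the former and multiplies the
  latter by \<open>m\<close>.\<close>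

definition D_res_coord :: "nat \<Rightarrow> complex \<Rightarrow> complex \<Rightarrow> complex" where
  "D_res_coord m z w = res_coord m z * Complex (Re (w / z)) (real m * Im (w / z))"

lemma res_coord_eq:
  "res_coord m z = (inverse (norm z) ^ (m - 1) * (1 / sqrt (real m))) *\<^sub>R z ^ m"
  by (simp add: res_coord_def scaleR_conv_of_real field_simps power_inverse)

lemma has_derivative_res_coord:
  assumes "z \<noteq> 0" "m > 0"
  shows "(res_coord m has_derivative D_res_coord m z) (at z)"
proof -
  obtain p where m: "m = Suc p" using \<open>m > 0\<close> gr0_conv_Suc by blast
  let ?r = "inverse (norm z)"
  let ?s = "1 / sqrt (real m)"
  have "((\<lambda>z. (inverse (norm z) ^ p * ?s) *\<^sub>R z ^ m) has_derivative
      (\<lambda>w. (?r ^ p * ?s) *\<^sub>R (of_nat m * w * z ^ (m - 1))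
         + ((of_nat p * (- (z \<bullet> w) * ?r ^ 3) * ?r ^ (p - 1)) * ?s) *\<^sub>R z ^ m)) (at z)"
    by (intro has_derivative_scaleR has_derivative_mult_left has_derivative_power
        has_derivative_inverse_norm[OF \<open>z \<noteq> 0\<close>] has_derivative_ident)
  also have "(\<lambda>w. (?r ^ p * ?s) *\<^sub>R (of_nat m * w * z ^ (m - 1))
         + ((of_nat p * (- (z \<bullet> w) * ?r ^ 3) * ?r ^ (p - 1)) * ?s) *\<^sub>R z ^ m) = D_res_coord m z"
  proof
    fix w
    define \<zeta> where "\<zeta> = w / z"
    have w: "w = \<zeta> * z" using \<open>z \<noteq> 0\<close> by (simp add: \<zeta>_def)
    have inner: "z \<bullet> w = (norm z)\<^sup>2 * Re \<zeta>"
      unfolding w by (simp only: cmod_power2 inner_complex_def times_complex.sel) algebra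
    have 1: "of_nat p * (- (z \<bullet> w) * ?r ^ 3) * ?r ^ (p - 1) = - (real p * Re \<zeta> * ?r ^ p)"
      using \<open>z \<noteq> 0\<close> unfolding inner
      by (cases p) (simp_all add: field_simps power2_eq_square power3_eq_cube)
    have 2: "of_nat m * w * z ^ (m - 1) = of_nat m * \<zeta> * z ^ m"
      by (simp add: w m)
    have 3: "Complex (Re \<zeta>) (real m * Im \<zeta>) = of_nat m * \<zeta> - of_real (real p * Re \<zeta>)"
      by (simp add: m complex_eq_iff algebra_simps)
    show "(?r ^ p * ?s) *\<^sub>R (of_nat m * w * z ^ (m - 1))
         + ((of_nat p * (- (z \<bullet> w) * ?r ^ 3) * ?r ^ (p - 1)) * ?s) *\<^sub>R z ^ m = D_res_coord m z w"
      unfolding D_res_coord_def \<zeta>_def[symmetric] res_coord_eq 1 2 3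
      by (simp add: scaleR_conv_of_real m algebra_simps add_divide_distrib diff_divide_distrib)
  qed
  finally show ?thesis
    by (simp add: m res_coord_eq[abs_def])
qed

lemma norm_res_coord: "m > 0 \<Longrightarrow> norm (res_coord m z) = norm z / sqrt (real m)"
  by (cases m; cases "z = 0")
    (simp_all add: res_coord_def norm_divide norm_mult norm_power power_0_left)

text \<open>The area form is preserved: the angular factor \<open>m\<close> cancels the factor \<open>1 / m\<close> in the
  square of the modulus.\<close>

lemma D_res_coord_symplectic:
  assumes "z \<noteq> 0" "m > 0"
  shows "Im (D_res_coord m z w * cnj (D_res_coord m z w')) = Im (w * cnj w')"
proof -
  define \<zeta> \<zeta>' where "\<zeta> = w / z" and "\<zeta>' = w' / z"
  have w: "w = z * \<zeta>" "w' = z * \<zeta>'" using \<open>z \<noteq> 0\<close> by (simp_all add: \<zeta>_def \<zeta>'_def)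
  have scale: "Im (c * x * cnj (c * y)) = (norm c)\<^sup>2 * Im (x * cnj y)" for c x y
    unfolding cmod_power2 by (simp add: power2_eq_square algebra_simps)
  have "Im (D_res_coord m z w * cnj (D_res_coord m z w')) =
      (norm z)\<^sup>2 / real m * (real m * Im (\<zeta> * cnj \<zeta>'))"
    unfolding D_res_coord_def \<zeta>_def[symmetric] \<zeta>'_def[symmetric] scale norm_res_coord[OF \<open>m > 0\<close>]
    by (simp add: power_divide algebra_simps)
  also have "\<dots> = Im (w * cnj w')"
    using \<open>m > 0\<close> unfolding w scale by simp
  finally show ?thesis .
qed

lemma D_res_coord_surj:
  assumes "z \<noteq> 0" "m > 0"
  shows "\<exists>w. D_res_coord m z w = u"
proof
  have "res_coord m z \<noteq> 0"
    using assms norm_res_coord[of m z] by auto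
  then show "D_res_coord m z (z * Complex (Re (u / res_coord m z)) (Im (u / res_coord m z) / real m)) = u"
    using assms by (simp add: D_res_coord_def)
qed

lemma nu_1: "nu (\<lambda>_. 1) j = 1"
  by (simp add: nu_def)

lemma nu_pos: "(\<And>j. n j > 0) \<Longrightarrow> nu n j > 0"
  by (simp add: nu_def prod_pos)

lemma f_res_eq: "f_res n a = (\<chi> j. res_coord (nu n j) (a $ j))"
  by (simp add: f_res_def res_coord_def)

definition D_f_res :: "('d::finite \<Rightarrow> nat) \<Rightarrow> complex ^ 'd \<Rightarrow> complex ^ 'd \<Rightarrow> complex ^ 'd" where
  "D_f_res n a v = (\<chi> j. D_res_coord (nu n j) (a $ j) (v $ j))"

lemma open_punctured_space: "open (punctured_space :: (complex ^ 'd) set)"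
proof -
  have "punctured_space = (\<Inter>j. {a :: complex ^ 'd. a $ j \<noteq> 0})"
    by (auto simp: punctured_space_def)
  also have "open \<dots>"
    by (intro open_INT finite ballI open_Collect_neq continuous_intros)
  finally show ?thesis .
qed

lemma f_res_1: "f_res (\<lambda>_. 1) a = a"
  unfolding f_res_def nu_1 by (simp add: vec_eq_iff)

context
  fixes n :: "'d::finite \<Rightarrow> nat" and a :: "complex ^ 'd"
  assumes n_pos: "\<And>j. n j > 0" and a: "a \<in> punctured_space"
begin

lemma coord_nonzero: "a $ j \<noteq> 0"
  using a by (simp add: punctured_space_def)

lemma f_res_in_punctured_space: "f_res n a \<in> punctured_space"
proof -
  have "norm (res_coord (nu n j) (a $ j)) \<noteq> 0" for j
    unfolding norm_res_coord[OF nu_pos[OF n_pos]] using coord_nonzero nu_pos[of n j, OF n_pos] by simp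
  then show ?thesis by (simp add: punctured_space_def f_res_eq)
qed

lemma has_derivative_f_res: "(f_res n has_derivative D_f_res n a) (at a)"
  unfolding f_res_eq[abs_def] D_f_res_def[abs_def]
proof (rule has_derivative_vec_lambda)
  show "((\<lambda>a. res_coord (nu n j) (a $ j)) has_derivative
      (\<lambda>v. D_res_coord (nu n j) (a $ j) (v $ j))) (at a)" for j
    using has_derivative_compose[OF bounded_linear_imp_has_derivative[OF bounded_linear_vec_nth]
        has_derivative_res_coord[OF coord_nonzero nu_pos[OF n_pos]]] .
qed

lemma D_f_res_symplectic: "Omega (D_f_res n a u) (D_f_res n a v) = Omega u v"
  unfolding Omega_eq_sum D_f_res_def vec_lambda_beta
    D_res_coord_symplectic[OF coord_nonzero nu_pos[OF n_pos]] ..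

lemma D_f_res_surj: obtains u where "D_f_res n a u = v"
proof -
  have "\<forall>j. \<exists>w. D_res_coord (nu n j) (a $ j) w = v $ j"
    using D_res_coord_surj[OF coord_nonzero nu_pos] n_pos by blast
  then obtain w where "\<And>j. D_res_coord (nu n j) (a $ j) (w j) = v $ j" by metis
  then have "D_f_res n a (\<chi> j. w j) = v" by (simp add: D_f_res_def vec_eq_iff)
  then show ?thesis using that by blast
qed

lemma D_f_res_inj:
  assumes "D_f_res n a u = D_f_res n a v"
  shows "u = v"
proof -
  have "Omega (u - v) w = 0" for w
    using D_f_res_symplectic[of u w] D_f_res_symplectic[of v w] assms by (simp add: Omega_diff_left)
  then show ?thesis using Omega_nondegenerate by fastforce
qed

lemma R_res_eq_R_res_1: "R_res n a = R_res (\<lambda>_. 1) (f_res n a)"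
  unfolding R_res_def nu_1 by (simp add: f_res_eq norm_res_coord nu_pos n_pos power_divide)

end


section \<open>The dual pair\<close>

text \<open>The flow of this field multiplies \<open>a\<^sub>j\<close> by \<open>exp (\<i> t / nu n j)\<close>: this is the \<open>n\<close>-resonant
  oscillator.\<close>

definition resonance_field :: "('d::finite \<Rightarrow> nat) \<Rightarrow> complex ^ 'd \<Rightarrow> complex ^ 'd" where
  "resonance_field n a = (\<chi> j. \<i> * (a $ j / of_nat (nu n j)))"

lemma has_derivative_R_res:
  "(R_res n has_derivative (\<lambda>v. Omega (resonance_field n a) v)) (at a)"
proof -
  have eq: "R_res n = (\<lambda>a. \<Sum>j\<in>UNIV. (a $ j \<bullet> a $ j) * (1 / (2 * real (nu n j))))"
    by (auto simp: R_res_def power2_norm_eq_inner sum_distrib_left)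
  have nth: "((\<lambda>a. a $ j) has_derivative (\<lambda>v. v $ j)) (at a)" for j
    by (rule bounded_linear_imp_has_derivative[OF bounded_linear_vec_nth])
  have "(R_res n has_derivative
      (\<lambda>v. \<Sum>j\<in>UNIV. (a $ j \<bullet> v $ j + v $ j \<bullet> a $ j) * (1 / (2 * real (nu n j))))) (at a)"
    unfolding eq
    by (intro has_derivative_sum has_derivative_mult_left has_derivative_inner nth)
  also have "(\<lambda>v. \<Sum>j\<in>UNIV. (a $ j \<bullet> v $ j + v $ j \<bullet> a $ j) * (1 / (2 * real (nu n j))))
      = (\<lambda>v. Omega (resonance_field n a) v)"
    unfolding Omega_eq_sum resonance_field_def
    by (intro ext sum.cong) (simp_all add: inner_complex_def add_divide_distrib mult.commute add.commute)
  finally show ?thesis .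
qed

text \<open>The resonance map carries the field of \<open>R_res n\<close> to that of \<open>R_res 1\<close>, whose flow is the
  common phase rotation.\<close>

lemma D_f_res_resonance_field:
  assumes "\<And>j. n j > 0" "a \<in> punctured_space"
  shows "D_f_res n a (t *\<^sub>R resonance_field n a) = t *\<^sub>R (\<chi> j. \<i> * f_res n a $ j)"
proof -
  have "D_res_coord (nu n j) (a $ j) (t *\<^sub>R (\<i> * (a $ j / of_nat (nu n j)))) =
      t *\<^sub>R (\<i> * res_coord (nu n j) (a $ j))" for j
  proof -
    have "t *\<^sub>R (\<i> * (a $ j / of_nat (nu n j))) / a $ j = Complex 0 (t / real (nu n j))"
      using coord_nonzero[OF assms, of j]
      by (simp add: scaleR_conv_of_real Complex_eq)
    then show ?thesis
      using nu_pos[of n j, OF assms(1)] by (simp add: D_res_coord_def complex_eq_iff)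
  qed
  then show ?thesis by (simp add: D_f_res_def resonance_field_def f_res_eq vec_eq_iff)
qed

lemma has_derivative_J_res:
  assumes "\<And>j. n j > 0" "a \<in> punctured_space"
  shows "(J_res n has_derivative (\<lambda>v. D_J_one (f_res n a) (D_f_res n a v))) (at a)"
  unfolding J_res_def o_def
  by (rule has_derivative_compose[OF has_derivative_f_res[OF assms] has_derivative_J_one])

lemma tangent_kernel_R_res:
  "tangent_kernel (R_res n) a = {v. Omega (resonance_field n a) v = 0}"
  by (simp add: tangent_kernel_def frechet_derivative_at[OF has_derivative_R_res, symmetric])

text \<open>The kernel of \<open>D_J_one\<close> at \<open>f_res n a\<close> is the phase direction, whose preimage under the injective map
  \<open>D_f_res n a\<close> is the line through the resonance field.\<close>

lemma tangent_kernel_J_res: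
  fixes n :: "'d::finite \<Rightarrow> nat"
  assumes "CARD('d) \<ge> 2" "\<And>j. n j > 0" "a \<in> punctured_space"
  shows "tangent_kernel (J_res n) a = range (\<lambda>t. t *\<^sub>R resonance_field n a)"
proof -
  have "D_J_one (f_res n a) (D_f_res n a v) = 0
      \<longleftrightarrow> (\<exists>t. D_f_res n a v = D_f_res n a (t *\<^sub>R resonance_field n a))" for v
    unfolding D_J_one_eq_0_iff[OF assms(1) f_res_in_punctured_space[OF assms(2,3)]]
      D_f_res_resonance_field[OF assms(2,3)] ..
  then have kernel: "v \<in> tangent_kernel (J_res n) a
      \<longleftrightarrow> (\<exists>t. D_f_res n a v = D_f_res n a (t *\<^sub>R resonance_field n a))" for v
    unfolding tangent_kernel_def mem_Collect_eq
      frechet_derivative_at[OF has_derivative_J_res[OF assms(2,3)], symmetric] .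
  show ?thesis
  proof (intro equalityI subsetI)
    fix v assume "v \<in> tangent_kernel (J_res n) a"
    then obtain t where "D_f_res n a v = D_f_res n a (t *\<^sub>R resonance_field n a)"
      unfolding kernel ..
    then have "v = t *\<^sub>R resonance_field n a" by (rule D_f_res_inj[OF assms(2,3)])
    then show "v \<in> range (\<lambda>t. t *\<^sub>R resonance_field n a)" by (rule range_eqI)
  next
    fix v assume "v \<in> range (\<lambda>t. t *\<^sub>R resonance_field n a)"
    then obtain t where "v = t *\<^sub>R resonance_field n a" by (rule rangeE)
    then show "v \<in> tangent_kernel (J_res n) a" unfolding kernel by (intro exI) (rule arg_cong)
  qed
qed

lemma dual_pair_resonance:
  fixes n :: "'d::finite \<Rightarrow> nat"
  assumes "CARD('d) \<ge> 2" "\<And>j. n j > 0"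
  shows "dual_pair punctured_space (R_res n) (J_res n)"
proof -
  have "resonance_field n a \<noteq> 0" if "a \<in> punctured_space" for a
  proof -
    have "resonance_field n a $ j \<noteq> 0" for j
      using coord_nonzero[OF assms(2) that, of j] nu_pos[of n j, OF assms(2)]
      by (simp add: resonance_field_def)
    then show ?thesis by (metis zero_index)
  qed
  then show ?thesis
    unfolding dual_pair_def
    by (simp add: tangent_kernel_R_res tangent_kernel_J_res[OF assms]
        symplectic_orthogonal_line symplectic_orthogonal_hyperplane)
qed


section \<open>The Poisson maps\<close>

lemma smooth_on_UNIV_differentiable:
  assumes "smooth_on UNIV F"
  shows "F differentiable (at x)"
proof -
  have "higher_differentiable_on UNIV F (Suc 0)"
    using assms unfolding smooth_on_def ..
  then show ?thesis by simp
qed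

lemma smooth_R_res: "smooth_on punctured_space (R_res n)"
  unfolding smooth_on_def
proof
  fix k
  have eq: "R_res n = (\<lambda>a. \<Sum>j\<in>UNIV. (a $ j \<bullet> a $ j) * (1 / (2 * real (nu n j))))"
    by (auto simp: R_res_def power2_norm_eq_inner sum_distrib_left)
  show "higher_differentiable_on punctured_space (R_res n) k"
    unfolding eq
    by (intro higher_differentiable_on_sum finite open_punctured_space
        higher_differentiable_on_compose_bounded_linear[OF open_punctured_space bounded_linear_mult_left]
        higher_differentiable_on_bilinear[OF open_punctured_space bounded_bilinear_inner]
        higher_differentiable_on_bounded_linear[OF open_punctured_space bounded_linear_vec_nth])
qed

text \<open>Both functions have differentials proportional to that of \<open>R_res n\<close>, and \<open>Omega\<close> is skew.\<close>

lemma poisson_map_R_res: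
  fixes n :: "'d::finite \<Rightarrow> nat"
  shows
  "poisson_map punctured_space canonical_bracket UNIV zero_bracket (R_res n)"
  unfolding poisson_map_def
proof (intro conjI allI impI ballI smooth_R_res)
  fix F G :: "real \<Rightarrow> real" and a :: "complex ^ 'd"
  assume smooth: "smooth_on UNIV F" "smooth_on UNIV G"
  have der: "\<exists>c. (H \<circ> R_res n has_derivative (\<lambda>v. Omega (c *\<^sub>R resonance_field n a) v)) (at a)"
    if "smooth_on UNIV H" for H
  proof
    let ?D = "frechet_derivative H (at (R_res n a))"
    have H: "(H has_derivative ?D) (at (R_res n a))"
      using smooth_on_UNIV_differentiable[OF that] by (simp only: frechet_derivative_works)
    define c where "c = ?D 1"
    have D: "?D x = c * x" for x
      using linear_cmul[OF has_derivative_linear[OF H], of x 1] unfolding c_def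
      by (simp only: real_scaleR_def mult.commute mult_1_right mult_1_left)
    show "(H \<circ> R_res n has_derivative (\<lambda>v. Omega (?D 1 *\<^sub>R resonance_field n a) v)) (at a)"
      using has_derivative_compose[OF has_derivative_R_res H]
      unfolding o_def D Omega_scaleR_left by (simp only: mult_1_right)
  qed
  obtain c c' where
    "(F \<circ> R_res n has_derivative (\<lambda>v. Omega (c *\<^sub>R resonance_field n a) v)) (at a)"
    "(G \<circ> R_res n has_derivative (\<lambda>v. Omega (c' *\<^sub>R resonance_field n a) v)) (at a)"
    using der smooth by blast
  then have "canonical_bracket (F \<circ> R_res n) (G \<circ> R_res n) a
      = Omega (c *\<^sub>R resonance_field n a) (c' *\<^sub>R resonance_field n a)"
    by (rule canonical_bracket_eq_Omega)
  also have "\<dots> = 0"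
    using Omega_skew[of "resonance_field n a" "resonance_field n a"]
    by (simp add: Omega_scaleR_left Omega_scaleR_right)
  finally show "canonical_bracket (F \<circ> R_res n) (G \<circ> R_res n) a = zero_bracket F G (R_res n a)"
    by (simp add: zero_bracket_def)
qed auto

lemma higher_differentiable_on_res_coord:
  "higher_differentiable_on punctured_space (\<lambda>a. res_coord m (a $ j)) k"
  unfolding res_coord_eq
  by (intro higher_differentiable_on_bilinear[OF open_punctured_space bounded_bilinear_scaleR]
      higher_differentiable_on_compose_bounded_linear[OF open_punctured_space bounded_linear_mult_left]
      higher_differentiable_on_power[OF open_punctured_space]
      higher_differentiable_on_inverse_norm[OF open_punctured_space bounded_linear_vec_nth]
      higher_differentiable_on_bounded_linear[OF open_punctured_space bounded_linear_vec_nth])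
    (simp add: punctured_space_def)

lemma higher_differentiable_on_J_one:
  fixes f :: "'a::real_normed_vector \<Rightarrow> complex ^ 'd"
  assumes "open S" "higher_differentiable_on S f k"
  shows "higher_differentiable_on S (\<lambda>x. J_one (f x)) k"
proof -
  have eq: "(\<lambda>x. J_one (f x)) = (\<lambda>x. \<chi> i j. \<i> * (f x $ i * cnj (f x $ j))
      + (f x \<bullet> f x) *\<^sub>R (if i = j then - \<i> / of_nat CARD('d) else 0))"
    by (auto simp: J_one_def vec_eq_iff power2_norm_eq_inner scaleR_conv_of_real algebra_simps)
  have nth: "higher_differentiable_on S (\<lambda>x. f x $ i) k" for i
    by (rule higher_differentiable_on_compose_bounded_linear[OF \<open>open S\<close> bounded_linear_vec_nth assms(2)])
  show ?thesis unfolding eq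
    by (intro higher_differentiable_on_vec_lambda[OF \<open>open S\<close>]
        higher_differentiable_on_add[OF \<open>open S\<close>]
        higher_differentiable_on_compose_bounded_linear[OF \<open>open S\<close> bounded_linear_mult_right]
        higher_differentiable_on_compose_bounded_linear[OF \<open>open S\<close> bounded_linear_cnj]
        higher_differentiable_on_compose_bounded_linear[OF \<open>open S\<close> bounded_linear_scaleR_left]
        higher_differentiable_on_bilinear[OF \<open>open S\<close> bounded_bilinear_mult]
        higher_differentiable_on_bilinear[OF \<open>open S\<close> bounded_bilinear_inner]
        nth assms(2))
qed

lemma smooth_J_res: "smooth_on punctured_space (J_res n)"
  unfolding smooth_on_def J_res_def o_def f_res_eq
  by (intro allI higher_differentiable_on_J_one higher_differentiable_on_vec_lambda
      open_punctured_space higher_differentiable_on_res_coord)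

text \<open>Since \<open>D_J_one\<close> takes values in \<open>su\<close>, only the restriction of the differential to \<open>su\<close>,
  hence the gradient, enters.\<close>

lemma frechet_derivative_D_J_one:
  assumes "F differentiable (at \<mu>)"
  shows "frechet_derivative F (at \<mu>) (D_J_one b v) = Omega (su_grad F \<mu> *v b) v"
  unfolding su_grad(2)[OF assms D_J_one_in_su, symmetric] su_inner_D_J_one[OF su_grad(1)[OF assms]] ..

text \<open>Surjectivity of \<open>D_f_res n a\<close> lifts the infinitesimal actions of the two gradients at
  \<open>f_res n a\<close> to vectors \<open>p\<close>, \<open>q\<close> at \<open>a\<close>. Symplecticity shows that these represent the differentials of
  the pulled-back functions and that \<open>Omega p q\<close> can be computed at \<open>f_res n a\<close>.\<close>

lemma poisson_map_J_res:
  fixes n :: "'d::finite \<Rightarrow> nat"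
  assumes "\<And>j. n j > 0"
  shows "poisson_map punctured_space canonical_bracket
    (J_one ` punctured_space) lie_poisson_bracket (J_res n)"
  unfolding poisson_map_def
proof (intro conjI allI impI ballI smooth_J_res)
  show "J_res n ` punctured_space \<subseteq> J_one ` punctured_space"
    unfolding J_res_def image_comp[symmetric]
    by (intro image_mono image_subsetI f_res_in_punctured_space[of n, OF assms])
next
  fix F G :: "complex ^ 'd ^ 'd \<Rightarrow> real" and a :: "complex ^ 'd"
  assume smooth: "smooth_on UNIV F" "smooth_on UNIV G" and a: "a \<in> punctured_space"
  let ?b = "f_res n a" and ?\<mu> = "J_res n a"
  have \<mu>: "?\<mu> = J_one ?b" by (simp add: J_res_def)
  note diff = smooth[THEN smooth_on_UNIV_differentiable]
  have der: "(H \<circ> J_res n has_derivative (\<lambda>v. Omega p v)) (at a)"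
    if H: "H differentiable (at ?\<mu>)" and p: "D_f_res n a p = su_grad H ?\<mu> *v ?b" for H p
  proof -
    have "(H \<circ> J_res n has_derivative
        (\<lambda>v. frechet_derivative H (at ?\<mu>) (D_J_one ?b (D_f_res n a v)))) (at a)"
      using has_derivative_compose[OF has_derivative_J_res[OF assms a]
          H[unfolded frechet_derivative_works]] unfolding o_def .
    then show ?thesis
      unfolding frechet_derivative_D_J_one[OF H] p[symmetric] D_f_res_symplectic[of n a, OF assms a] .
  qed
  obtain p where p: "D_f_res n a p = su_grad F ?\<mu> *v ?b"
    by (rule D_f_res_surj[of n a, OF assms a])
  obtain q where q: "D_f_res n a q = su_grad G ?\<mu> *v ?b"
    by (rule D_f_res_surj[of n a, OF assms a])
  have "canonical_bracket (F \<circ> J_res n) (G \<circ> J_res n) a = Omega p q"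
    by (rule canonical_bracket_eq_Omega[OF der[OF diff(1) p] der[OF diff(2) q]])
  also have "\<dots> = Omega (su_grad F ?\<mu> *v ?b) (su_grad G ?\<mu> *v ?b)"
    unfolding p[symmetric] q[symmetric] D_f_res_symplectic[of n a, OF assms a] ..
  also have "\<dots> = lie_poisson_bracket F G ?\<mu>"
    unfolding lie_poisson_bracket_def
    by (rule su_inner_J_one_commutator[OF su_grad(1)[OF diff(1)] su_grad(1)[OF diff(2)],
          of ?b, folded \<mu>, symmetric])
  finally show "canonical_bracket (F \<circ> J_res n) (G \<circ> J_res n) a = lie_poisson_bracket F G ?\<mu>" .
qed

theorem theorem3p3:
  fixes n :: "'d::finite \<Rightarrow> nat"
  assumes "CARD('d) \<ge> 2"
    and "\<forall>j. n j > 0"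
  shows
    "poisson_map punctured_space canonical_bracket UNIV zero_bracket (R_res n) \<and>
     (J_one ` punctured_space :: (complex ^ 'd ^ 'd) set) \<subseteq> su \<and>
     poisson_map punctured_space canonical_bracket
       (J_one ` punctured_space) lie_poisson_bracket (J_res n) \<and>
     dual_pair punctured_space (R_res n) (J_res n) \<and>
     f_res n ` punctured_space \<subseteq> punctured_space \<and>
     (\<forall>b \<in> punctured_space. J_res (\<lambda>_. 1 :: nat) b = J_one (b :: complex ^ 'd)) \<and>
     (\<forall>a \<in> punctured_space. R_res n a = R_res (\<lambda>_. 1) (f_res n a)) \<and>
     (\<forall>a \<in> punctured_space. J_res n a = J_one (f_res n a))"
proof -
  have n: "\<And>j. n j > 0" using assms(2) by blast
  show ?thesis
  proof (intro conjI ballI)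
    show "poisson_map punctured_space canonical_bracket UNIV zero_bracket (R_res n)"
      by (rule poisson_map_R_res)
    show "(J_one ` punctured_space :: (complex ^ 'd ^ 'd) set) \<subseteq> su"
      by (intro image_subsetI J_one_in_su)
    show "poisson_map punctured_space canonical_bracket
        (J_one ` punctured_space) lie_poisson_bracket (J_res n)"
      by (rule poisson_map_J_res[of n, OF n])
    show "dual_pair punctured_space (R_res n) (J_res n)"
      by (rule dual_pair_resonance[of n, OF assms(1) n])
    show "f_res n ` punctured_space \<subseteq> punctured_space"
      by (intro image_subsetI f_res_in_punctured_space[of n, OF n])
    show "J_res (\<lambda>_. 1) b = J_one b" for b :: "complex ^ 'd"
      by (simp only: J_res_def o_apply f_res_1)
    show "R_res n a = R_res (\<lambda>_. 1) (f_res n a)" if "a \<in> punctured_space" for a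
      by (rule R_res_eq_R_res_1[of n a, OF n that])
    show "J_res n a = J_one (f_res n a)" for a
      by (simp only: J_res_def o_apply)
  qed
qed

end
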